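(* Let $(X,\mathfrak{C})$ and $(Y,\mathfrak{C}')$ be two connected large scale resemblance spaces that are large scale equivalent. Then $\operatorname{asdim}_{\mathfrak{C}}X=\operatorname{asdim}_{\mathfrak{C}'}Y$. That is, for every integer $n\ge 0$, $\operatorname{asdim}_{\mathfrak{C}}X\le n$ if and only if $\operatorname{asdim}_{\mathfrak{C}'}Y\le n$.
   Context: $\mathcal{P}(X)$ is the power set of $X$. A large scale resemblance (LS.R) on a nonempty set $X$ is $\mathfrak{C}\subseteq\mathcal{P}(\mathcal{P}(X))$ such that: (i) $\{A\}\in\mathfrak{C}$ for all $A\subseteq X$; (ii) if $\mathcal{B}\subseteq\mathcal{A}\in\mathfrak{C}$ then $\mathcal{B}\in\mathfrak{C}$; (iii) if $\mathcal{A},\mathcal{B}\in\mathfrak{C}$ and $\mathcal{A}\cap\mathcal{B}\ne\emptyset$ then $\mathcal{A}\cup\mathcal{B}\in\mathfrak{C}$; (iv) if $\mathcal{A},\mathcal{B}\in\mathfrak{C}$ then $\mathcal{A}\vee\mathcal{B}=\{A\cup B\mid A\in\mathcal{A},B\in\mathcal{B}\}\in\mathfrak{C}$. The pair $(X,\mathfrak{C})$ is an LS.R space. It is connected if $\{\{x\},\{y\}\}\in\mathfrak{C}$ for all $x,y\in X$. A set $B\subseteq X$ is bounded if $B=\emptyset$ or $\{B,\{x\}\}\in\mathfrak{C}$ for some $x\in X$. For a map $f:X\to Y$ and $\mathcal{A}\subseteq\mathcal{P}(X)$, $f(\mathcal{A})=\{f(A)\mid A\in\mathcal{A}\}$. A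 map $f:(X,\mathfrak{C})\to(Y,\mathfrak{C}')$ is an LS.R mapping if inverse images of bounded sets are bounded and $f(\mathcal{A})\in\mathfrak{C}'$ for all $\mathcal{A}\in\mathfrak{C}$. An LS.R mapping $f:X\to Y$ is a large scale equivalence if there is an LS.R mapping $g:Y\to X$ such that for all $\mathcal{A}\subseteq\mathcal{P}(X)$ and $\mathcal{B}\subseteq\mathcal{P}(Y)$: if $g\circ f(\mathcal{A})\in\mathfrak{C}$ then $g\circ f(\mathcal{A})\cup\mathcal{A}\in\mathfrak{C}$, and if $f\circ g(\mathcal{B})\in\mathfrak{C}'$ then $f\circ g(\mathcal{B})\cup\mathcal{B}\in\mathfrak{C}'$. Two LS.R spaces are large scale equivalent if there is a large scale equivalence between them. A family $\mathcal{U}\subseteq\mathcal{P}(X)$ is uniformly bounded in $(X,\mathfrak{C})$ if for every nonempty $\mathcal{V}\subseteq\mathcal{U}$ the family $\mathcal{A}_{\mathcal{V}}=\{A\subseteq X\mid A\subseteq\bigcup_{U\in\mathcal{V}}U\text{ and }A\cap U\neq\emptyset\text{ for all }U\in\mathcal{V}\}$ belongs to $\mathfrak{C}$. $\mathcal{U}$ refines $\mathcal{V}$ if each $U\in\mathcal{U}$ is contained in some $V\in\mathcal{V}$. The multiplicity of a cover is the smallest $n$ (if any) such that each point lies in at most $n$ of its members. For an integer $n\ge0$, $\operatorname{asdim}_{\mathfrak{C}}X\le n$ means that each uniformly bounded cover $\mathcal{U}$ of $X$ refines some uniformly bounded cover $\mathcal{V}$ of $X$ of multiplicity at most $n+1$.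 $\operatorname{asdim}_{\mathfrak{C}}X$ is the least such $n$, or $\infty$ if there is none. *)

theory Defs
  imports Main "HOL-Library.FuncSet" "HOL-Library.Extended_Nat"
begin

locale ls_resemblance =
  fixes X :: "'a set" and C :: "'a set set set"
  assumes nonempty: "X \<noteq> {}"
    and families: "C \<subseteq> Pow (Pow X)"
    and singleton: "A \<subseteq> X \<Longrightarrow> {A} \<in> C"
    and subfamily: "\<A> \<in> C \<Longrightarrow> \<B> \<subseteq> \<A> \<Longrightarrow> \<B> \<in> C"
    and union: "\<A> \<in> C \<Longrightarrow> \<B> \<in> C \<Longrightarrow> \<A> \<inter> \<B> \<noteq> {} \<Longrightarrow> \<A> \<union> \<B> \<in> C"
    and join: "\<A> \<in> C \<Longrightarrow> \<B> \<in> C \<Longrightarrow> {A \<union> B | A B. A \<in> \<A> \<and> B \<in> \<B>} \<in> C"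

definition ls_connected :: "'a set \<Rightarrow> 'a set set set \<Rightarrow> bool" where
  "ls_connected X C \<longleftrightarrow> (\<forall>x\<in>X. \<forall>y\<in>X. {{x}, {y}} \<in> C)"

definition ls_bounded :: "'a set \<Rightarrow> 'a set set set \<Rightarrow> 'a set \<Rightarrow> bool" where
  "ls_bounded X C B \<longleftrightarrow> B \<subseteq> X \<and> (B = {} \<or> (\<exists>x\<in>X. {B, {x}} \<in> C))"

definition image_family :: "('a \<Rightarrow> 'b) \<Rightarrow> 'a set set \<Rightarrow> 'b set set" where
  "image_family f \<A> = {f ` A | A. A \<in> \<A>}"

text \<open>Maps between carriers are total functions; only their values on \<open>X\<close> matter, hence the
  intersection with \<open>X\<close> in inverse images.\<close>

definition ls_mapping ::
  "'a set \<Rightarrow> 'a set set set \<Rightarrow> 'b set \<Rightarrow> 'b set set set \<Rightarrow> ('a \<Rightarrow> 'b) \<Rightarrow> bool" where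
  "ls_mapping X C Y D f \<longleftrightarrow> f \<in> X \<rightarrow> Y
     \<and> (\<forall>B. ls_bounded Y D B \<longrightarrow> ls_bounded X C (f -` B \<inter> X))
     \<and> (\<forall>\<A>\<in>C. image_family f \<A> \<in> D)"

definition large_scale_equivalence ::
  "'a set \<Rightarrow> 'a set set set \<Rightarrow> 'b set \<Rightarrow> 'b set set set \<Rightarrow> ('a \<Rightarrow> 'b) \<Rightarrow> bool" where
  "large_scale_equivalence X C Y D f \<longleftrightarrow> ls_mapping X C Y D f
     \<and> (\<exists>g. ls_mapping Y D X C g
          \<and> (\<forall>\<A>. \<A> \<subseteq> Pow X \<longrightarrow> image_family (g \<circ> f) \<A> \<in> C
                 \<longrightarrow> image_family (g \<circ> f) \<A> \<union> \<A> \<in> C)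
          \<and> (\<forall>\<B>. \<B> \<subseteq> Pow Y \<longrightarrow> image_family (f \<circ> g) \<B> \<in> D
                 \<longrightarrow> image_family (f \<circ> g) \<B> \<union> \<B> \<in> D))"

definition large_scale_equivalent ::
  "'a set \<Rightarrow> 'a set set set \<Rightarrow> 'b set \<Rightarrow> 'b set set set \<Rightarrow> bool" where
  "large_scale_equivalent X C Y D \<longleftrightarrow> (\<exists>f. large_scale_equivalence X C Y D f)"

definition uniformly_bounded :: "'a set \<Rightarrow> 'a set set set \<Rightarrow> 'a set set \<Rightarrow> bool" where
  "uniformly_bounded X C \<U> \<longleftrightarrow> \<U> \<subseteq> Pow X
     \<and> (\<forall>\<V>. \<V> \<subseteq> \<U> \<longrightarrow> \<V> \<noteq> {} \<longrightarrow>
          {A. A \<subseteq> X \<and> A \<subseteq> \<Union>\<V> \<and> (\<forall>U\<in>\<V>. A \<inter> U \<noteq> {})} \<in> C)"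

definition is_cover :: "'a set \<Rightarrow> 'a set set \<Rightarrow> bool" where
  "is_cover X \<U> \<longleftrightarrow> \<U> \<subseteq> Pow X \<and> \<Union>\<U> = X"

definition family_refines :: "'a set set \<Rightarrow> 'a set set \<Rightarrow> bool" where
  "family_refines \<U> \<V> \<longleftrightarrow> (\<forall>U\<in>\<U>. \<exists>V\<in>\<V>. U \<subseteq> V)"

text \<open>On \<^typ>\<open>enat\<close> the infimum of a nonempty set is its least element and the infimum of the
  empty set is \<open>\<infinity>\<close>, so the next two notions are \<open>\<infinity>\<close> when there is no suitable number.\<close>

definition cover_multiplicity :: "'a set \<Rightarrow> 'a set set \<Rightarrow> enat" where
  "cover_multiplicity X \<U> =
     Inf {enat n | n. \<forall>x\<in>X. finite {U \<in> \<U>. x \<in> U} \<and> card {U \<in> \<U>. x \<in> U} \<le> n}"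

definition asdim_le :: "'a set \<Rightarrow> 'a set set set \<Rightarrow> nat \<Rightarrow> bool" where
  "asdim_le X C n \<longleftrightarrow>
     (\<forall>\<U>. is_cover X \<U> \<longrightarrow> uniformly_bounded X C \<U> \<longrightarrow>
        (\<exists>\<V>. is_cover X \<V> \<and> uniformly_bounded X C \<V> \<and> family_refines \<U> \<V>
           \<and> cover_multiplicity X \<V> \<le> enat (n + 1)))"

definition asdim :: "'a set \<Rightarrow> 'a set set set \<Rightarrow> enat" where
  "asdim X C = Inf {enat n | n. asdim_le X C n}"

end

theory Submission
  imports Defs
begin

text \<open>Images and preimages of uniformly bounded families under a large scale equivalence \<open>f\<close> are
  uniformly bounded. The image \<open>f(\<U>)\<close> of a cover only covers \<open>f(X)\<close>, but adding all singletons
  keeps it uniformly bounded: a set meeting every member of \<open>\<V>\<close> and containing \<open>S\<close>, inside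
  \<open>\<Union>\<V> \<union> S\<close>, is a set in \<open>\<A>\<^sub>\<V>\<close> joined with \<open>S\<close>, and resemblances are closed under joins.
  So a cover of \<open>X\<close> is pushed to \<open>Y\<close>, refined there, and the result is pulled back along \<open>f\<close>, which
  does not raise the multiplicity.\<close>

lemma uniformly_boundedD:
  assumes "uniformly_bounded X C \<U>" "\<V> \<subseteq> \<U>" "\<V> \<noteq> {}"
  shows "{A. A \<subseteq> X \<and> A \<subseteq> \<Union>\<V> \<and> (\<forall>U\<in>\<V>. A \<inter> U \<noteq> {})} \<in> C"
  using assms unfolding uniformly_bounded_def by blast

lemma uniformly_bounded_Un_singletons:
  assumes "ls_resemblance X C" and \<U>: "uniformly_bounded X C \<U>"
  shows "uniformly_bounded X C (\<U> \<union> (\<lambda>x. {x}) ` X)"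
proof -
  interpret ls_resemblance X C by fact
  have sub: "\<U> \<subseteq> Pow X" using \<U> unfolding uniformly_bounded_def by blast
  have "{A. A \<subseteq> X \<and> A \<subseteq> \<Union>\<W> \<and> (\<forall>U\<in>\<W>. A \<inter> U \<noteq> {})} \<in> C"
    if \<W>: "\<W> \<subseteq> \<U> \<union> (\<lambda>x. {x}) ` X" "\<W> \<noteq> {}" for \<W>
  proof -
    let ?F = "\<lambda>\<V>. {A. A \<subseteq> X \<and> A \<subseteq> \<Union>\<V> \<and> (\<forall>U\<in>\<V>. A \<inter> U \<noteq> {})}"
    define \<V> where "\<V> = \<W> \<inter> \<U>"
    \<comment> \<open>The two parts may overlap, as a singleton can already lie in
      \<open>\<U>\<close>. Only their union and the inclusion \<open>S \<subseteq> A\<close> matter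
      below.\<close>
    define S where "S = {x \<in> X. {x} \<in> \<W>}"
    have S: "{S} \<in> C" by (rule singleton) (auto simp: S_def)
    have un: "\<Union>\<W> = \<Union>\<V> \<union> S"
      using \<W> sub by (auto simp: \<V>_def S_def)
    have S_sub: "S \<subseteq> A" if "A \<in> ?F \<W>" for A
    proof
      fix x assume "x \<in> S"
      then have "A \<inter> {x} \<noteq> {}" using that unfolding S_def by blast
      then show "x \<in> A" by simp
    qed
    show ?thesis
    proof (cases "\<V> = {}")
      case True
      \<comment> \<open>Uniform boundedness says nothing about an empty \<open>\<V>\<close>, but
        here \<open>S \<subseteq> A \<subseteq> S\<close> leaves only one candidate.\<close>
      have "A \<in> {S}" if "A \<in> ?F \<W>" for A
        using S_sub[OF that] that un True by auto
      then show ?thesis by (intro subfamily[OF S] subsetI)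
    next
      case False
      have V: "?F \<V> \<in> C" using uniformly_boundedD[OF \<U> _ False] unfolding \<V>_def by blast
      have "A \<in> {P \<union> Q |P Q. P \<in> ?F \<V> \<and> Q \<in> {S}}" if A: "A \<in> ?F \<W>" for A
      proof -
        have "A = (A \<inter> \<Union>\<V>) \<union> S" using S_sub[OF A] A un by blast
        moreover have "A \<inter> \<Union>\<V> \<in> ?F \<V>" using A unfolding \<V>_def by blast
        ultimately show ?thesis by blast
      qed
      then show ?thesis by (intro subfamily[OF join[OF V S]] subsetI)
    qed
  qed
  then show ?thesis using sub unfolding uniformly_bounded_def by blast
qed

text \<open>A set that lies in a union of images f(U) and meets each of them is itself the image of
  a set lying in the union of the U and meeting each U. The family to control is thus part of the
  image of a member of \<open>C\<close>.\<close>

lemma uniformly_bounded_image: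
  assumes "ls_resemblance Y D" and f: "ls_mapping X C Y D f"
    and \<U>: "uniformly_bounded X C \<U>"
  shows "uniformly_bounded Y D ((`) f ` \<U>)"
proof -
  interpret ls_resemblance Y D by fact
  have sub: "\<U> \<subseteq> Pow X" using \<U> unfolding uniformly_bounded_def by blast
  have fXY: "f \<in> X \<rightarrow> Y" using f unfolding ls_mapping_def by blast
  have "{B. B \<subseteq> Y \<and> B \<subseteq> \<Union>\<W> \<and> (\<forall>U\<in>\<W>. B \<inter> U \<noteq> {})} \<in> D"
    if \<W>: "\<W> \<subseteq> (`) f ` \<U>" "\<W> \<noteq> {}" for \<W>
  proof -
    obtain \<V> where V: "\<V> \<subseteq> \<U>" "\<W> = (`) f ` \<V>" using \<W>(1) unfolding subset_image_iff by blast
    let ?F = "{A. A \<subseteq> X \<and> A \<subseteq> \<Union>\<V> \<and> (\<forall>U\<in>\<V>. A \<inter> U \<noteq> {})}"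
    have "?F \<in> C" using \<W>(2) unfolding V(2) by (intro uniformly_boundedD[OF \<U> V(1)]) simp
    then have D: "image_family f ?F \<in> D" using f unfolding ls_mapping_def by blast
    have "B \<in> image_family f ?F"
      if B: "B \<subseteq> \<Union>\<W>" "\<forall>U\<in>\<W>. B \<inter> U \<noteq> {}" for B
    proof -
      \<comment> \<open>The preimage is cut down to \<open>\<Union>\<V>\<close>, not merely to
        \<open>X\<close>, since \<open>f\<close> may also send points outside
        \<open>\<Union>\<V>\<close> into \<open>B\<close>.\<close>
      have "B = f ` (f -` B \<inter> \<Union>\<V>)" using B(1) unfolding V(2) by blast
      moreover have "f -` B \<inter> \<Union>\<V> \<subseteq> X" using V(1) sub by blast
      moreover have "(f -` B \<inter> \<Union>\<V>) \<inter> U \<noteq> {}" if "U \<in> \<V>" for U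
      proof -
        have "B \<inter> f ` U \<noteq> {}" using B(2) that unfolding V(2) by simp
        then obtain x where "x \<in> U" "f x \<in> B" by auto
        then show ?thesis using that by auto
      qed
      ultimately show ?thesis
        unfolding image_family_def by (intro CollectI exI[of _ "f -` B \<inter> \<Union>\<V>"]) simp
    qed
    then show ?thesis by (intro subfamily[OF D]) blast
  qed
  moreover have "(`) f ` \<U> \<subseteq> Pow Y" using sub fXY by blast
  ultimately show ?thesis unfolding uniformly_bounded_def by blast
qed

text \<open>The family travels forward along \<open>f\<close> into one in \<open>D\<close> and back
  along \<open>g\<close> into one in \<open>C\<close>; closeness of \<open>g \<circ> f\<close> to
  the identity then compares it with the original.\<close>

lemma uniformly_bounded_vimage:
  assumes "ls_resemblance X C" "ls_resemblance Y D"
    and f: "ls_mapping X C Y D f" and g: "ls_mapping Y D X C g"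
    and gf: "\<And>\<A>. \<A> \<subseteq> Pow X \<Longrightarrow> image_family (g \<circ> f) \<A> \<in> C
                 \<Longrightarrow> image_family (g \<circ> f) \<A> \<union> \<A> \<in> C"
    and \<V>: "uniformly_bounded Y D \<V>"
  shows "uniformly_bounded X C ((\<lambda>V. f -` V \<inter> X) ` \<V>)"
proof -
  interpret X: ls_resemblance X C by fact
  interpret Y: ls_resemblance Y D by fact
  have fXY: "f \<in> X \<rightarrow> Y" using f unfolding ls_mapping_def by blast
  have "{A. A \<subseteq> X \<and> A \<subseteq> \<Union>\<W> \<and> (\<forall>U\<in>\<W>. A \<inter> U \<noteq> {})} \<in> C" (is "?F \<in> C")
    if \<W>: "\<W> \<subseteq> (\<lambda>V. f -` V \<inter> X) ` \<V>" "\<W> \<noteq> {}" for \<W>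
  proof -
    obtain \<V>' where V: "\<V>' \<subseteq> \<V>" "\<W> = (\<lambda>V. f -` V \<inter> X) ` \<V>'"
      using \<W>(1) unfolding subset_image_iff by blast
    let ?G = "{B. B \<subseteq> Y \<and> B \<subseteq> \<Union>\<V>' \<and> (\<forall>V\<in>\<V>'. B \<inter> V \<noteq> {})}"
    have "?G \<in> D"
      using \<W>(2) unfolding V(2) by (intro uniformly_boundedD[OF \<V> V(1)]) simp
    moreover have "f ` A \<in> ?G" if A: "A \<in> ?F" for A
    proof (intro CollectI conjI ballI)
      show "f ` A \<subseteq> Y" using A fXY by auto
      show "f ` A \<subseteq> \<Union>\<V>'" using A unfolding V(2) by blast
      show "f ` A \<inter> V \<noteq> {}" if "V \<in> \<V>'" for V
      proof -
        have "A \<inter> (f -` V \<inter> X) \<noteq> {}" using A that unfolding V(2) by simp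
        then show ?thesis by auto
      qed
    qed
    then have "image_family f ?F \<subseteq> ?G"
      unfolding image_family_def Setcompr_eq_image by (simp only: Collect_mem_eq image_subsetI)
    ultimately have "image_family f ?F \<in> D" by (rule Y.subfamily)
    then have "image_family g (image_family f ?F) \<in> C"
      using g unfolding ls_mapping_def by blast
    moreover have "image_family g (image_family f ?F) = image_family (g \<circ> f) ?F"
      unfolding image_family_def by (auto simp: image_comp)
    \<comment> \<open>\<open>gf\<close> adjoins \<open>?F\<close> to its own image under
      \<open>g \<circ> f\<close>, after which \<open>?F\<close> is a subfamily of a member of
      \<open>C\<close>.\<close>
    ultimately have "image_family (g \<circ> f) ?F \<union> ?F \<in> C" by (intro gf) auto
    then show ?thesis by (rule X.subfamily) blast
  qed
  then show ?thesis unfolding uniformly_bounded_def by blast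
qed

text \<open>The members through \<open>x\<close> are the preimages of the members through
  \<open>f x\<close>; different sets may share a preimage, so their number can only drop.\<close>

lemma cover_multiplicity_vimage_le:
  assumes "f \<in> X \<rightarrow> Y"
  shows "cover_multiplicity X ((\<lambda>V. f -` V \<inter> X) ` \<V>) \<le> cover_multiplicity Y \<V>"
proof -
  have "finite {U \<in> (\<lambda>V. f -` V \<inter> X) ` \<V>. x \<in> U} \<and>
      card {U \<in> (\<lambda>V. f -` V \<inter> X) ` \<V>. x \<in> U} \<le> n"
    if "\<forall>y\<in>Y. finite {V \<in> \<V>. y \<in> V} \<and> card {V \<in> \<V>. y \<in> V} \<le> n" "x \<in> X" for x n
  proof -
    have "{U \<in> (\<lambda>V. f -` V \<inter> X) ` \<V>. x \<in> U} = (\<lambda>V. f -` V \<inter> X) ` {V \<in> \<V>. f x \<in> V}"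
      using that(2) by auto
    moreover have "finite {V \<in> \<V>. f x \<in> V}" "card {V \<in> \<V>. f x \<in> V} \<le> n"
      using that assms by auto
    ultimately show ?thesis by (auto intro: order_trans[OF card_image_le])
  qed
  \<comment> \<open>Every bound valid on \<open>Y\<close> is valid on \<open>X\<close>, and an
    infimum over a larger set is smaller. If there is no bound on \<open>Y\<close>, the right-hand
    side is \<infinity>.\<close>
  then show ?thesis unfolding cover_multiplicity_def by (intro Inf_superset_mono) blast
qed

lemma asdim_le_pullback:
  assumes X: "ls_resemblance X C" and Y: "ls_resemblance Y D"
    and f: "ls_mapping X C Y D f" and g: "ls_mapping Y D X C g"
    and gf: "\<And>\<A>. \<A> \<subseteq> Pow X \<Longrightarrow> image_family (g \<circ> f) \<A> \<in> C
                 \<Longrightarrow> image_family (g \<circ> f) \<A> \<union> \<A> \<in> C"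
    and n: "asdim_le Y D n"
  shows "asdim_le X C n"
  unfolding asdim_le_def
proof (intro allI impI)
  fix \<U> assume cover: "is_cover X \<U>" and \<U>: "uniformly_bounded X C \<U>"
  have fXY: "f \<in> X \<rightarrow> Y" using f unfolding ls_mapping_def by blast
  define \<W> where "\<W> = (`) f ` \<U> \<union> (\<lambda>y. {y}) ` Y"
  have "uniformly_bounded Y D \<W>"
    unfolding \<W>_def by (intro uniformly_bounded_Un_singletons uniformly_bounded_image[OF Y f \<U>] Y)
  \<comment> \<open>Uniform boundedness supplies \<open>\<W> \<subseteq> Pow Y\<close>; the
    singletons supply the points outside f(X).\<close>
  moreover from this have "is_cover Y \<W>"
    unfolding is_cover_def uniformly_bounded_def by (auto simp: \<W>_def)
  ultimately obtain \<V> where \<V>: "is_cover Y \<V>" "uniformly_bounded Y D \<V>"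
      "family_refines \<W> \<V>" "cover_multiplicity Y \<V> \<le> enat (n + 1)"
    using n unfolding asdim_le_def by blast
  let ?\<P> = "(\<lambda>V. f -` V \<inter> X) ` \<V>"
  have "\<Union>?\<P> = f -` (\<Union>\<V>) \<inter> X" by blast
  also have "\<dots> = X" using \<V>(1) funcset_mem[OF fXY] unfolding is_cover_def by blast
  finally have "is_cover X ?\<P>" unfolding is_cover_def by (intro conjI) blast+
  moreover have "uniformly_bounded X C ?\<P>"
    by (rule uniformly_bounded_vimage[OF X Y f g gf \<V>(2)])
  \<comment> \<open>If f(U) lies in \<open>V\<close>, then \<open>U\<close> lies in the preimage of
    \<open>V\<close>, so refinement survives the pullback.\<close>
  moreover have "\<exists>P\<in>?\<P>. U \<subseteq> P" if "U \<in> \<U>" for U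
  proof -
    have "f ` U \<in> \<W>" using that by (simp add: \<W>_def)
    then obtain V where "V \<in> \<V>" "f ` U \<subseteq> V"
      using \<V>(3) unfolding family_refines_def by metis
    moreover have "U \<subseteq> X" using cover that unfolding is_cover_def by auto
    ultimately have "U \<subseteq> f -` V \<inter> X" by auto
    with \<open>V \<in> \<V>\<close> show ?thesis by (rule rev_bexI[OF imageI])
  qed
  then have "family_refines \<U> ?\<P>" unfolding family_refines_def by (rule ballI)
  moreover have "cover_multiplicity X ?\<P> \<le> enat (n + 1)"
    using cover_multiplicity_vimage_le[OF fXY] \<V>(4) by (rule order_trans)
  ultimately show "\<exists>\<V>. is_cover X \<V> \<and> uniformly_bounded X C \<V> \<and> family_refines \<U> \<V>
      \<and> cover_multiplicity X \<V> \<le> enat (n + 1)" by blast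
qed

theorem theorem5p8:
  fixes X :: "'a set" and C :: "'a set set set"
    and Y :: "'b set" and D :: "'b set set set"
  assumes "ls_resemblance X C" and "ls_resemblance Y D"
    and "ls_connected X C" and "ls_connected Y D"
    and "large_scale_equivalent X C Y D"
  shows "asdim X C = asdim Y D \<and> (\<forall>n::nat. asdim_le X C n \<longleftrightarrow> asdim_le Y D n)"
proof -
  obtain f g where f: "ls_mapping X C Y D f" and g: "ls_mapping Y D X C g"
    and gf: "\<And>\<A>. \<A> \<subseteq> Pow X \<Longrightarrow> image_family (g \<circ> f) \<A> \<in> C
                 \<Longrightarrow> image_family (g \<circ> f) \<A> \<union> \<A> \<in> C"
    and fg: "\<And>\<B>. \<B> \<subseteq> Pow Y \<Longrightarrow> image_family (f \<circ> g) \<B> \<in> D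
                 \<Longrightarrow> image_family (f \<circ> g) \<B> \<union> \<B> \<in> D"
    using assms(5) unfolding large_scale_equivalent_def large_scale_equivalence_def by blast
  \<comment> \<open>The two implications come from the same lemma with the roles of \<open>f\<close>
    and \<open>g\<close> exchanged.\<close>
  have "asdim_le X C n \<longleftrightarrow> asdim_le Y D n" for n
    using asdim_le_pullback[OF assms(1,2) f g gf] asdim_le_pullback[OF assms(2,1) g f fg] by blast
  \<comment> \<open>Both dimensions are infima of the same set of bounds, which also settles the
    value \<infinity>.\<close>
  then show ?thesis unfolding asdim_def by simp
qed

end
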